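(* Let $A$ be an admissible set of addition chains. The order type of $\mathscr{D}^A\cap[0,2]$ is $\omega^2$, while for any real $r<2$ the set $\mathscr{D}^A\cap[0,r]$ has order type strictly less than $\omega^2$. Furthermore, every defect in $\mathscr{D}^A\cap[0,2]$ is $A$-stable, and so the order type of $\mathscr{D}^A_{st}\cap[0,2]$ is $\omega^2$.
   Context: An addition chain for a positive integer $n$ is a sequence $(a_0,\ldots,a_r)$ with $a_0=1$, $a_r=n$, and for every $1\le k\le r$ there exist $0\le i,j<k$ with $a_k=a_i+a_j$; $r$ is its length. For a set $A$ of addition chains, $\ell^A(n)$ is the least length of an addition chain for $n$ belonging to $A$. $\nu_2(n)$ is the number of $1$'s in the binary expansion of $n$. $A$ is admissible if (i) for every $n\ge1$, $\ell^A(n)$ is defined and $\ell^A(n)\le\lfloor\log_2 n\rfloor+\nu_2(n)-1$, and (ii) for every $n\ge1$, $\ell^A(2n)\le\ell^A(n)+1$. The $A$-defect is $\delta^A(n)=\ell^A(n)-\log_2 n$, and $\mathscr{D}^A=\{\delta^A(n):n\ge1\}$. A positive integer $m$ is $A$-stable if $\ell^A(2^k m)=\ell^A(m)+k$ for all $k\ge0$; a defect is $A$-stable if it equals $\delta^A(m)$ for some $A$-stable $m$, and $\mathscr{D}^A_{st}$ is the set of $A$-stable defects. *)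

theory Defs
  imports Complex_Main
begin

(* The sequence (a_0, ..., a_r) is the list c, so r = length c - 1. *)
definition addition_chain_for :: "nat \<Rightarrow> nat list \<Rightarrow> bool" where
  "addition_chain_for n c \<longleftrightarrow>
     c \<noteq> [] \<and> c ! 0 = 1 \<and> c ! (length c - 1) = n \<and>
     (\<forall>k. 1 \<le> k \<and> k < length c \<longrightarrow> (\<exists>i<k. \<exists>j<k. c ! k = c ! i + c ! j))"

definition addition_chains :: "nat list set" where
  "addition_chains = {c. \<exists>n\<ge>1. addition_chain_for n c}"

definition chain_length :: "nat list \<Rightarrow> nat" where
  "chain_length c = length c - 1"

definition ell_defined :: "nat list set \<Rightarrow> nat \<Rightarrow> bool" where
  "ell_defined A n \<longleftrightarrow> (\<exists>c\<in>A. addition_chain_for n c)"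

(* Meaningful only if ell_defined A n. *)
definition ell :: "nat list set \<Rightarrow> nat \<Rightarrow> nat" where
  "ell A n = (LEAST r. \<exists>c\<in>A. addition_chain_for n c \<and> chain_length c = r)"

definition nu2 :: "nat \<Rightarrow> nat" where
  "nu2 n = card {k. bit n k}"

definition admissible :: "nat list set \<Rightarrow> bool" where
  "admissible A \<longleftrightarrow>
     (\<forall>n\<ge>1. ell_defined A n \<and>
        int (ell A n) \<le> \<lfloor>log 2 (real n)\<rfloor> + int (nu2 n) - 1) \<and>
     (\<forall>n\<ge>1. ell A (2 * n) \<le> ell A n + 1)"

definition defect :: "nat list set \<Rightarrow> nat \<Rightarrow> real" where
  "defect A n = real (ell A n) - log 2 (real n)"

definition defects :: "nat list set \<Rightarrow> real set" where
  "defects A = {defect A n | n. n \<ge> 1}"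

definition stable_number :: "nat list set \<Rightarrow> nat \<Rightarrow> bool" where
  "stable_number A m \<longleftrightarrow> m \<ge> 1 \<and> (\<forall>k. ell A (2 ^ k * m) = ell A m + k)"

definition stable_defect :: "nat list set \<Rightarrow> real \<Rightarrow> bool" where
  "stable_defect A d \<longleftrightarrow> (\<exists>m. stable_number A m \<and> d = defect A m)"

definition stable_defects :: "nat list set \<Rightarrow> real set" where
  "stable_defects A = {d. stable_defect A d}"

(* The ordinal omega^2, represented by the lexicographic order on pairs of naturals. *)
definition omega_sq :: "(nat \<times> nat) rel" where
  "omega_sq = {((a, b), (c, d)). a < c \<or> a = c \<and> b \<le> d}"

lemma Field_omega_sq: "Field omega_sq = UNIV"
  by (auto simp: Field_def omega_sq_def)

lemma Well_order_omega_sq: "Well_order omega_sq"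
proof -
  have "omega_sq - Id = less_than <*lex*> less_than"
    by (auto simp: omega_sq_def)
  then have "wf (omega_sq - Id)"
    by (simp add: wf_lex_prod)
  moreover have "linear_order omega_sq"
    unfolding linear_order_on_def partial_order_on_def preorder_on_def
    by (auto simp: omega_sq_def refl_on_def trans_def antisym_def total_on_def)
  ultimately show ?thesis
    by (simp add: well_order_on_def Field_omega_sq)
qed

(* Membership in ordIso and ordLess requires both relations to be well-orders,
   so these assert in particular that S is well-ordered by the usual order of the reals. *)
definition has_order_type :: "real set \<Rightarrow> 'a rel \<Rightarrow> bool" where
  "has_order_type S r \<longleftrightarrow> (relation_of (\<le>) S, r) \<in> ordIso"

definition order_type_less :: "real set \<Rightarrow> 'a rel \<Rightarrow> bool" where
  "order_type_less S r \<longleftrightarrow> (relation_of (\<le>) S, r) \<in> ordLess"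

end

theory Submission
  imports Defs
begin

text \<open>Only numbers n with chain length at most \<open>\<lfloor>log 2 n\<rfloor> + 2\<close> have defect at most 2, and
  then the defect is less than 2. If the excess over \<open>\<lfloor>log 2 n\<rfloor>\<close> is at most 1, then n is a
  power of two or a sum of two of them; together with admissibility this forces stability.

  In a chain with bounded defect the number of non-doubling steps is bounded. Hence either all of
  its steps \<open>x = y + z\<close> have balanced summands, which bounds the odd part of n, or some step has
  \<open>y\<close> much larger than \<open>z\<close>. In the second case replacing \<open>x\<close> by \<open>y\<close> shortens the chain by
  one step while changing n by a small factor only, so n is close to a number of smaller excess.
  Therefore the defects in [0,2] accumulate, from the left only, exactly at 1,
  \<open>2 - log 2 (1 + 1/2^k)\<close> for \<open>k \<ge> 1\<close>, and 2, which cuts them into \<open>\<omega>\<close> blocks of type \<open>\<omega>\<close>.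
  The numbers \<open>2^b + 1\<close> and \<open>2^(a+b) + 2^b + 1\<close> show that each block is infinite.\<close>

subsection \<open>Addition chains as finite sets\<close>

text \<open>Only the underlying set of a chain is kept. Since 0 is excluded, both summands of an
  element are smaller than it, so the increasing enumeration is again an addition chain, of length
  \<open>card S - 1\<close>.\<close>

definition chain_set :: "nat set \<Rightarrow> bool" where
  "chain_set S \<longleftrightarrow> finite S \<and> 0 \<notin> S \<and> 1 \<in> S \<and>
     (\<forall>x\<in>S. x = 1 \<or> (\<exists>y\<in>S. \<exists>z\<in>S. x = y + z))"

lemma chain_set_finite: "chain_set S \<Longrightarrow> finite S"
  by (simp add: chain_set_def)

lemma chain_set_pos: "chain_set S \<Longrightarrow> x \<in> S \<Longrightarrow> 0 < x"
  by (metis chain_set_def gr0I)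

lemma chain_set_restrict:
  assumes "chain_set S" "1 \<le> n"
  shows "chain_set (S \<inter> {..n})"
  using assms unfolding chain_set_def by (fastforce dest: add_leD1 add_leD2)

lemma chain_set_insert:
  assumes "chain_set S" "y \<in> S" "z \<in> S"
  shows "chain_set (insert (y + z) S)"
  using assms unfolding chain_set_def by auto

text \<open>The largest element is never a summand, so deleting it leaves a chain set. Hence every
  chain set arises from \<open>{1}\<close> by adjoining ever larger sums.\<close>

lemma chain_set_induct [consumes 1, case_names base step]:
  assumes "chain_set S"
    and "P {1}"
    and step: "\<And>S y z. chain_set S \<Longrightarrow> y \<in> S \<Longrightarrow> z \<in> S \<Longrightarrow> z \<le> y \<Longrightarrow>
        (\<forall>x\<in>S. x < y + z) \<Longrightarrow> P S \<Longrightarrow> P (insert (y + z) S)"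
  shows "P S"
  using assms(1)
proof (induction "card S" arbitrary: S rule: less_induct)
  case less
  define n where "n = Max S"
  have fin: "finite S" and one: "1 \<in> S"
    using less.prems by (auto simp: chain_set_def)
  have n: "n \<in> S" "\<And>x. x \<in> S \<Longrightarrow> x \<le> n"
    unfolding n_def using fin one by (auto intro: Max_in)
  show ?case
  proof (cases "n = 1")
    case True
    then have "x = 1" if "x \<in> S" for x
      using n(2)[OF that] chain_set_pos[OF less.prems that] by simp
    then have "S = {1}" using one by blast
    then show ?thesis using assms(2) by simp
  next
    case False
    obtain u v where "u \<in> S" "v \<in> S" "n = u + v"
      using less.prems n(1) False unfolding chain_set_def by blast
    then obtain y z where yz: "y \<in> S" "z \<in> S" "n = y + z" "z \<le> y"
      by (metis add.commute nat_le_linear)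
    define T where "T = S - {n}"
    have "chain_set T"
    proof -
      have "n > 1" using False chain_set_pos[OF less.prems n(1)] by simp
      have "x \<le> n - 1 \<longleftrightarrow> x \<noteq> n" if "x \<in> S" for x
        using n(2)[OF that] \<open>n > 1\<close> by linarith
      then have "T = S \<inter> {..n - 1}" unfolding T_def by blast
      then show ?thesis using chain_set_restrict[OF less.prems, of "n - 1"] \<open>n > 1\<close> by simp
    qed
    moreover have "y \<in> T" "z \<in> T"
      using yz chain_set_pos[OF less.prems, of y] chain_set_pos[OF less.prems, of z] by (auto simp: T_def)
    moreover have "\<forall>x\<in>T. x < y + z"
      unfolding T_def using n(2) yz(3) by (auto simp: order.strict_iff_order)
    moreover have "P T"
      using less.hyps[of T] \<open>chain_set T\<close> card_Diff1_less[OF fin n(1)] by (simp add: T_def)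
    ultimately have "P (insert (y + z) T)"
      using step yz(4) by blast
    moreover have "insert (y + z) T = S"
      using yz(3) n(1) by (auto simp: T_def)
    ultimately show ?thesis by simp
  qed
qed

lemma chain_set_size:
  assumes "chain_set S" "x \<in> S"
  shows "2 * x \<le> 2 ^ card S"
  using assms
proof (induction arbitrary: x rule: chain_set_induct)
  case base
  then show ?case by simp
next
  case (step S y z)
  have "card (insert (y + z) S) = Suc (card S)"
    using step.hyps chain_set_finite by (subst card_insert_disjoint) auto
  moreover have "2 * y \<le> 2 ^ card S" "2 * z \<le> 2 ^ card S" "x \<in> S \<Longrightarrow> 2 * x \<le> 2 ^ card S"
    using step by blast+
  ultimately show ?case using step.prems by auto
qed

text \<open>The size bound is reached only by doubling an element that reaches the bound of the
  smaller set, so every step is a doubling.\<close>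

lemma chain_set_powers:
  assumes "chain_set S" "x \<in> S" "2 ^ card S \<le> 2 * x" "y \<in> S"
  shows "\<exists>i. y = 2 ^ i"
  using assms
proof (induction arbitrary: x y rule: chain_set_induct)
  case base
  then show ?case by (auto intro: exI[of _ 0])
next
  case (step S u v)
  have card: "card (insert (u + v) S) = Suc (card S)"
    using step.hyps chain_set_finite by (subst card_insert_disjoint) auto
  have le: "2 * u \<le> 2 ^ card S" "2 * v \<le> 2 ^ card S" "x \<in> S \<Longrightarrow> 2 * x \<le> 2 ^ card S"
    using step.hyps chain_set_size by blast+
  have pos: "(2::nat) ^ card S > 0" by simp
  have x: "x = u + v" "2 ^ card S \<le> u + v"
    using step.prems(1,2) le card pos by auto
  then have eq: "u = v" "2 ^ card S \<le> 2 * u" using le by auto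
  then have powers: "\<And>w. w \<in> S \<Longrightarrow> \<exists>i. w = 2 ^ i"
    using step.IH[of u] step.hyps by blast
  then obtain i where "u = 2 ^ i" using step.hyps by blast
  then have "u + v = 2 ^ Suc i" using eq by simp
  then show ?case using powers step.prems(3) by blast
qed

section \<open>Numbers with at most two binary ones, and chains that lose at most a factor 2 against
  doubling\<close>

definition two_powers :: "nat \<Rightarrow> bool" where
  "two_powers n \<longleftrightarrow> (\<exists>i. n = 2 ^ i) \<or> (\<exists>i j. n = 2 ^ i + 2 ^ j)"

lemma two_powers_double: "two_powers n \<Longrightarrow> two_powers (2 * n)"
  unfolding two_powers_def by (metis distrib_left power_Suc)

lemma two_powers_normal:
  assumes "two_powers n" "2 ^ t \<le> n" "n < 2 ^ Suc t"
  shows "n = 2 ^ t \<or> (\<exists>e<t. n = 2 ^ t + 2 ^ e)"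
proof -
  have single: "n = 2 ^ t" if "n = 2 ^ i" for i
  proof -
    have "t \<le> i" "i < Suc t" using that assms(2,3)
      using power_le_imp_le_exp[of 2 t i] power_less_imp_less_exp[of 2 i "Suc t"] by auto
    then show ?thesis using that by (simp add: le_antisym less_Suc_eq_le)
  qed
  have double: ?thesis if "n = 2 ^ i + 2 ^ j" "j \<le> i" for i j
  proof (cases "i = j")
    case True
    then have "n = 2 ^ Suc i" using that by simp
    then show ?thesis using single by blast
  next
    case False
    then have "j < i" using that by simp
    have "(2::nat) ^ j < 2 ^ i" using \<open>j < i\<close> by simp
    moreover have "(2::nat) ^ Suc i = 2 * 2 ^ i" by simp
    ultimately have "(2::nat) ^ t < 2 ^ Suc i" "(2::nat) ^ i < 2 ^ Suc t"
      using that(1) assms(2,3) by linarith+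
    then have "t < Suc i" "i < Suc t" by (simp_all only: power_strict_increasing_iff one_less_numeral_iff semiring_norm)
    then have "i = t" by simp
    then show ?thesis using that \<open>j < i\<close> by blast
  qed
  from assms(1) consider i where "n = 2 ^ i" | i j where "n = 2 ^ i + 2 ^ j" "j \<le> i"
    unfolding two_powers_def by (metis add.commute nat_le_linear)
  then show ?thesis using single double by cases blast+
qed

lemma two_powers_half:
  assumes "two_powers (2 * n)"
  shows "two_powers n"
proof -
  have A: ?thesis if "2 * n = 2 ^ i" for i
    using that by (cases i) (auto simp: two_powers_def)
  have B: ?thesis if eq: "2 * n = 2 ^ i + 2 ^ j" for i j
  proof (cases "i = j")
    case True
    then have "n = 2 ^ i" using eq by simp
    then show ?thesis unfolding two_powers_def by blast
  next
    case False
    have "even ((2::nat) ^ i + 2 ^ j)" using eq by (metis dvd_triv_left)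
    then have "i = 0 \<longleftrightarrow> j = 0" by auto
    then obtain i' j' where "i = Suc i'" "j = Suc j'"
      using False by (metis not0_implies_Suc)
    then have "n = 2 ^ i' + 2 ^ j'" using eq by simp
    then show ?thesis unfolding two_powers_def by blast
  qed
  show ?thesis using assms A B unfolding two_powers_def[of "2 * n"] by blast
qed

lemma two_powers_cancel: "two_powers (2 ^ k * n) \<Longrightarrow> two_powers n"
  by (induction k) (auto simp: mult.assoc dest: two_powers_half)

text \<open>Below position \<open>t\<close> the ones of \<open>y\<close> and \<open>z\<close> must
  add up to at least \<open>2 ^ t\<close>; the resulting carries merge them and leave at most one
  further one.\<close>

lemma two_powers_carry:
  assumes y: "two_powers y" "y < 2 ^ Suc t" and z: "two_powers z" "z < 2 ^ t"
    and sum: "2 ^ Suc t \<le> y + z"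
  shows "two_powers (y + z)"
proof -
  have "2 ^ t < y" using z sum by simp
  then obtain e where e: "e < t" "y = 2 ^ t + 2 ^ e"
    using two_powers_normal[OF y(1) _ y(2)] by fastforce
  obtain u where u: "t = Suc u" using e by (cases t) auto
  have z1: "2 ^ u \<le> z"
  proof -
    have "(2::nat) ^ e \<le> 2 ^ u" using e(1) u by (intro power_increasing) auto
    moreover have "(2::nat) ^ t = 2 * 2 ^ u" "(2::nat) ^ Suc t = 2 * 2 ^ t" by (simp_all add: u)
    ultimately show ?thesis using sum e(2) by linarith
  qed
  show ?thesis
  proof (cases "e = u")
    case True
    have "z = 2 ^ u \<or> (\<exists>q<u. z = 2 ^ u + 2 ^ q)"
      using two_powers_normal[OF z(1) z1] z(2) u by simp
    moreover have "2 ^ t + 2 ^ e + 2 ^ u = (2::nat) ^ Suc t" by (simp add: u True)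
    ultimately show ?thesis unfolding two_powers_def e(2) by (metis add.assoc)
  next
    case False
    \<comment> \<open>Here \<open>2 ^ e + 2 ^ q\<close> must make up the missing
      \<open>2 ^ u\<close>, which forces both exponents to be \<open>u - 1\<close>.\<close>
    then obtain v where v: "u = Suc v" "e \<le> v" using e(1) u
      by (metis Suc_leI less_Suc_eq not0_implies_Suc not_less_zero less_Suc_eq_le)
    have ev: "(2::nat) ^ e \<le> 2 ^ v" using v(2) by (intro power_increasing) auto
    have pows: "(2::nat) ^ u = 2 * 2 ^ v" "(2::nat) ^ t = 2 * 2 ^ u" "(2::nat) ^ Suc t = 2 * 2 ^ t"
      by (simp_all add: u v(1))
    have "z \<noteq> 2 ^ u" using sum e(2) ev pows zero_less_power[of "2::nat" v] by linarith
    then obtain q where q: "q < u" "z = 2 ^ u + 2 ^ q"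
      using two_powers_normal[OF z(1) z1] z(2) u by auto
    have "(2::nat) ^ q \<le> 2 ^ v" using q(1) v(1) by (intro power_increasing) auto
    then have "y + z = 2 ^ Suc t"
      using sum q(2) e(2) ev pows by linarith
    then show ?thesis unfolding two_powers_def by blast
  qed
qed

text \<open>Either the factor 2 is lost at the last step, and all earlier elements are powers of
  two, or it was lost before. In the latter case the larger summand of the last step satisfies the
  hypothesis for the smaller set, so both summands have at most two ones and only their sum remains
  to be examined.\<close>

lemma chain_set_two_powers:
  assumes "chain_set S" "x \<in> S" "2 ^ card S \<le> 4 * x" "y \<in> S"
  shows "two_powers y"
  using assms
proof (induction arbitrary: x y rule: chain_set_induct)
  case base
  then show ?case by (auto simp: two_powers_def intro: exI[of _ 0])
next
  case (step S u v)
  have card: "card (insert (u + v) S) = Suc (card S)"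
    using step.hyps chain_set_finite by (subst card_insert_disjoint) auto
  have tight: "two_powers w" if "x' \<in> S" "2 ^ card S \<le> 2 * x'" "w \<in> insert (u + v) S" for x' w
    using chain_set_powers[OF step.hyps(1) that(1,2)] that(3) step.hyps(2,3)
    unfolding two_powers_def by blast
  show ?case
  proof (cases "\<exists>x'\<in>S. 2 ^ card S \<le> 2 * x'")
    case True
    then show ?thesis using tight step.prems(3) by blast
  next
    case False
    then have small: "2 * w < 2 ^ card S" if "w \<in> S" for w using that by (meson not_le)
    have sum: "2 ^ card S \<le> 2 * (u + v)"
      using step.prems(1,2) card small by fastforce
    have tp: "two_powers w" if "w \<in> S" for w
      using step.IH[OF step.hyps(2) _ that] sum step.hyps(4) by simp
    have "card S \<noteq> 0" using step.hyps(1,2) chain_set_finite by auto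
    moreover have "card S \<noteq> 1" using small[OF step.hyps(2)] chain_set_pos[OF step.hyps(1,2)] by auto
    ultimately obtain t where t: "card S = Suc (Suc t)"
      by (metis One_nat_def not0_implies_Suc)
    have "two_powers (u + v)"
    proof (cases "u = v")
      case True
      then show ?thesis using two_powers_double[OF tp[OF step.hyps(2)]] by (simp add: mult_2)
    next
      case neq: False
      show ?thesis
      proof (cases "v < 2 ^ t")
        case True
        show ?thesis
          by (rule two_powers_carry[of _ t])
            (use tp step.hyps True small[of u] sum t in auto)
      next
        case ge: False
        \<comment> \<open>The elements up to \<open>v\<close> omit \<open>u\<close> and form a
          smaller chain set, whose size bound gives \<open>v \<le> 2 ^ t\<close>.\<close>
        define T where "T = S \<inter> {..v}"
        have "u \<notin> T" using neq step.hyps(4) by (auto simp: T_def)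
        then have "T \<subset> S" using step.hyps(2) by (auto simp: T_def)
        then have "card T \<le> Suc t"
          using psubset_card_mono[of S T] chain_set_finite[OF step.hyps(1)] t by simp
        moreover have "2 * v \<le> 2 ^ card T"
          using chain_set_size[OF chain_set_restrict[OF step.hyps(1), of v]] step.hyps(3)
            chain_set_pos[OF step.hyps(1,3)] by (auto simp: T_def)
        ultimately have "2 * v \<le> 2 ^ Suc t"
          by (meson le_trans one_le_numeral power_increasing)
        then have v: "v = 2 ^ t" using ge by simp
        then obtain e where "u = 2 ^ t + 2 ^ e"
          using two_powers_normal[OF tp[OF step.hyps(2)], of t] step.hyps(4) small[OF step.hyps(2)] neq t
          by auto
        then have "u + v = 2 ^ Suc t + 2 ^ e" using v by simp
        then show ?thesis unfolding two_powers_def by blast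
      qed
    qed
    then show ?thesis using step.prems(3) tp by blast
  qed
qed

text \<open>Send the unbalanced sum \<open>y0 + z0\<close> to \<open>y0\<close>, fix what was
  adjoined before it, and recompute each later sum from the images of its summands. The collision
  with \<open>y0\<close> loses an element, and both bounds on \<open>g\<close> are linear, hence
  preserved by addition.\<close>

lemma chain_set_truncate:
  fixes G :: nat
  assumes "chain_set S" "y0 \<in> S" "z0 \<in> S" "y0 + z0 \<in> S" "G * z0 < y0"
  shows "\<exists>g. (\<forall>x\<in>S. g x \<le> x \<and> G * x \<le> (G + 1) * g x) \<and> chain_set (g ` S) \<and> card (g ` S) < card S"
  using assms
proof (induction rule: chain_set_induct)
  case base
  then show ?case by simp
next
  case (step S y z)
  have fin: "finite S" using step.hyps(1) by (rule chain_set_finite)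
  have new: "y + z \<notin> S" using step.hyps by blast
  show ?case
  proof (cases "y0 + z0 = y + z")
    case True
    have "z0 > 0" "y0 > 0"
      using chain_set_pos[OF chain_set_insert[OF step.hyps(1-3)]] step.prems by auto
    then have "y0 \<in> S" using step.prems True by auto
    let ?g = "\<lambda>x. if x = y + z then y0 else x"
    have img: "?g ` insert (y + z) S = S" using new \<open>y0 \<in> S\<close> by (force simp: image_iff)
    have "G * (y + z) \<le> (G + 1) * y0"
      using step.prems(4) True[symmetric] by (simp add: algebra_simps)
    then show ?thesis
      using img step.hyps(1) fin new True by (intro exI[of _ ?g]) auto
  next
    case False
    then have old: "y0 + z0 \<in> S" using step.prems by auto
    then have "y0 + z0 < y + z" using step.hyps by blast
    then have "y0 \<in> S" "z0 \<in> S" using step.prems by auto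
    then obtain g where g: "\<And>x. x \<in> S \<Longrightarrow> g x \<le> x" "\<And>x. x \<in> S \<Longrightarrow> G * x \<le> (G + 1) * g x"
      "chain_set (g ` S)" "card (g ` S) < card S"
      using step.IH old step.prems(4) by blast
    let ?g = "g(y + z := g y + g z)"
    have img: "?g ` insert (y + z) S = insert (g y + g z) (g ` S)"
      using new by (auto simp: image_iff)
    have "chain_set (?g ` insert (y + z) S)"
      unfolding img using g(3) step.hyps by (intro chain_set_insert) auto
    moreover have "card (?g ` insert (y + z) S) < card (insert (y + z) S)"
      unfolding img using g(4) fin new
      by (metis Suc_less_eq card_insert_disjoint card_insert_le_m1 card_insert_if finite_imageI less_SucI)
    moreover have "\<forall>x\<in>insert (y + z) S. ?g x \<le> x \<and> G * x \<le> (G + 1) * ?g x"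
      using g(1,2) new g(1,2)[OF step.hyps(2)] g(1,2)[OF step.hyps(3)]
      by (auto simp: algebra_simps)
    ultimately show ?thesis by blast
  qed
qed

text \<open>Here \<open>f\<close> is the number of non-doubling steps. The bound on sums of two distinct elements
  makes the induction work: it lets a non-doubling step gain at most the factor 5/3 instead of 2.\<close>
lemma chain_set_balanced:
  fixes G :: nat
  assumes "chain_set S" "\<forall>y\<in>S. \<forall>z\<in>S. y + z \<in> S \<longrightarrow> y \<le> G * z"
  shows "\<exists>f. (\<forall>x\<in>S. 2 * real x \<le> 2 ^ card S * (5/6) ^ f) \<and>
     (\<forall>x\<in>S. \<forall>y\<in>S. x \<noteq> y \<longrightarrow> 2 * real (x + y) \<le> 2 ^ card S * (5/6) ^ f * (5/3)) \<and>
     (\<forall>x\<in>S. \<exists>i m. x = 2 ^ i * m \<and> m \<le> (G + 1) ^ f)"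
  using assms
proof (induction rule: chain_set_induct)
  case base
  show ?case by (intro exI[of _ 0]) (auto intro: exI[of _ 0])
next
  case (step S y z)
  have fin: "finite S" using step.hyps(1) by (rule chain_set_finite)
  have new: "y + z \<notin> S" using step.hyps by blast
  have card: "card (insert (y + z) S) = Suc (card S)" using fin new by simp
  obtain f where f: "\<And>x. x \<in> S \<Longrightarrow> 2 * real x \<le> 2 ^ card S * (5/6) ^ f"
     "\<And>x y. x \<in> S \<Longrightarrow> y \<in> S \<Longrightarrow> x \<noteq> y \<Longrightarrow> 2 * real (x + y) \<le> 2 ^ card S * (5/6) ^ f * (5/3)"
     "\<And>x. x \<in> S \<Longrightarrow> \<exists>i m. x = 2 ^ i * m \<and> m \<le> (G + 1) ^ f"
  proof -
    have "\<forall>y\<in>S. \<forall>z\<in>S. y + z \<in> S \<longrightarrow> y \<le> G * z" using step.prems by simp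
    from step.IH[OF this] that show thesis by blast
  qed
  define b :: real where "b = 2 ^ card S * (5/6) ^ f"
  have b: "b > 0" by (simp add: b_def)
  note f1 = f(1)[folded b_def] and f2 = f(2)[folded b_def]
  show ?case
  proof (cases "y = z")
    case True
    obtain i m where "y = 2 ^ i * m" "m \<le> (G + 1) ^ f" using f(3) step.hyps(2) by blast
    then have "y + z = 2 ^ Suc i * m" "m \<le> (G + 1) ^ f" using True by auto
    then have "\<forall>x\<in>insert (y + z) S. \<exists>i m. x = 2 ^ i * m \<and> m \<le> (G + 1) ^ f"
      using f(3) by blast
    moreover have "2 ^ card (insert (y + z) S) * (5/6) ^ f = 2 * b"
      by (simp add: card b_def)
    moreover have "\<forall>x\<in>insert (y + z) S. 2 * real x \<le> 2 * b"
      using f1 b step.hyps(2,3) by (fastforce simp: True)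
    moreover have "2 * real (v + w) \<le> 2 * b * (5/3)"
      if "v \<in> insert (y + z) S" "w \<in> insert (y + z) S" "v \<noteq> w" for v w
      using that f1[of v] f1[of w] f1[OF step.hyps(3)] b True
      by auto
    ultimately show ?thesis by (intro exI[of _ f]) auto
  next
    case False
    obtain i m where y: "y = 2 ^ i * m" "m \<le> (G + 1) ^ f" using f(3) step.hyps(2) by blast
    obtain j k where z: "z = 2 ^ j * k" "k \<le> (G + 1) ^ f" using f(3) step.hyps(3) by blast
    have near: "y \<le> G * z" using step.prems step.hyps(2,3) by blast
    then have G: "G \<ge> 1" using chain_set_pos[OF step.hyps(1,2)] by (cases G) auto
    have mono: "m \<le> (G + 1) ^ Suc f" if "m \<le> (G + 1) ^ f" for m
      using that le_trans[OF _ power_increasing[of f "Suc f" "G + 1"]] by simp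
    have new_odd: "\<exists>i m. y + z = 2 ^ i * m \<and> m \<le> (G + 1) ^ Suc f"
    \<comment> \<open>Factor out the smaller power of two. The other summand is controlled by
      \<open>z \<le> y\<close> in the first case and by \<open>y \<le> G * z\<close> in the
      second.\<close>
    proof (cases "i \<le> j")
      case True
      define d where "d = j - i"
      have j: "j = i + d" using True by (simp add: d_def)
      have eq: "y + z = 2 ^ i * (m + 2 ^ d * k)" using y z j by (simp add: power_add algebra_simps)
      have "2 ^ i * (2 ^ d * k) \<le> 2 ^ i * m" using step.hyps(4) y z j by (simp add: power_add mult.assoc)
      then have "m + 2 ^ d * k \<le> 2 * m" by simp
      also have "\<dots> \<le> (G + 1) * (G + 1) ^ f" using G y(2) by (intro mult_mono) auto
      finally show ?thesis using eq by auto
    next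
      case False
      define d where "d = i - j"
      have i: "i = j + d" using False by (simp add: d_def)
      have eq: "y + z = 2 ^ j * (2 ^ d * m + k)" using y z i by (simp add: power_add algebra_simps)
      have "2 ^ j * (2 ^ d * m) \<le> 2 ^ j * (G * k)" using near y z i by (simp add: power_add mult_ac)
      then have "2 ^ d * m + k \<le> (G + 1) * k" by simp
      also have "\<dots> \<le> (G + 1) * (G + 1) ^ f" using z(2) by (intro mult_left_mono) auto
      finally show ?thesis using eq by auto
    qed
    have "\<forall>x\<in>insert (y + z) S. \<exists>i m. x = 2 ^ i * m \<and> m \<le> (G + 1) ^ Suc f"
    proof
      fix x assume "x \<in> insert (y + z) S"
      then consider "x = y + z" | "x \<in> S" by blast
      then show "\<exists>i m. x = 2 ^ i * m \<and> m \<le> (G + 1) ^ Suc f"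
        using new_odd f(3)[of x] mono by cases blast+
    qed
    moreover have eq: "2 ^ card (insert (y + z) S) * (5/6) ^ Suc f = b * (5/3)"
      by (simp add: card b_def)
    moreover have yz: "2 * real (y + z) \<le> b * (5/3)"
      using f2 step.hyps(2,3) False by blast
    moreover have "\<forall>x\<in>insert (y + z) S. 2 * real x \<le> b * (5/3)"
      using f1 b yz by fastforce
    \<comment> \<open>The induction closes because \<open>1 + 5/3 \<le> (5/3)^2\<close>: 5/3 is a
      rational number above the golden ratio and below 2, and 5/6 is its half.\<close>
    moreover have "2 * real (v + w) \<le> b * (5/3) * (5/3)"
      if vw: "v \<in> insert (y + z) S" "w \<in> insert (y + z) S" "v \<noteq> w" for v w
      using vw f1[of v] f1[of w] yz b by auto
    ultimately show ?thesis unfolding eq[symmetric] by blast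
  qed
qed

text \<open>An unbalanced step is truncated. If there is none, \<open>2 ^ card S \<le> 8 * n\<close>
  leaves \<open>(5/6) ^ f \<ge> 1/4\<close>, so at most 7 steps are not doublings, and each of them
  costs a factor \<open>G + 1\<close> in the bound on the cofactor \<open>m\<close>.\<close>

lemma chain_set_dichotomy:
  fixes G :: nat
  assumes "chain_set S" "n \<in> S" "2 ^ card S \<le> 8 * n"
  shows "(\<exists>i m. n = 2 ^ i * m \<and> m \<le> (G + 1) ^ 7) \<or>
    (\<exists>T n'. chain_set T \<and> n' \<in> T \<and> card T < card S \<and> n' \<le> n \<and> G * n \<le> (G + 1) * n')"
proof (cases "\<exists>y\<in>S. \<exists>z\<in>S. y + z \<in> S \<and> G * z < y")
  case True
  then obtain y z where "y \<in> S" "z \<in> S" "y + z \<in> S" "G * z < y" by blast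
  from chain_set_truncate[OF assms(1) this] show ?thesis
    using assms(2) by blast
next
  case False
  then obtain f where f: "2 * real n \<le> 2 ^ card S * (5/6) ^ f"
    "\<exists>i m. n = 2 ^ i * m \<and> m \<le> (G + 1) ^ f"
    using chain_set_balanced[OF assms(1), of G] assms(2) by (meson not_le)
  have "(2::real) ^ card S \<le> 8 * real n"
    using assms(3) by (metis of_nat_le_iff of_nat_mult of_nat_numeral of_nat_power)
  then have "2 * real n \<le> 8 * real n * (5/6) ^ f"
    using f(1) by (meson le_trans mult_right_mono order_trans zero_le_power zero_le_divide_iff zero_le_numeral)
  moreover have "n > 0" using chain_set_pos assms by blast
  ultimately have le: "1 / 4 \<le> (5/6::real) ^ f" by simp
  have "f \<le> 7"
  proof (rule ccontr)
    assume "\<not> f \<le> 7"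
    then have "(5/6::real) ^ f \<le> (5/6) ^ 8" by (intro power_decreasing) auto
    moreover have "(5/6::real) ^ 8 < 1 / 4" by (simp add: power_divide)
    ultimately show False using le by linarith
  qed
  then have le': "(G + 1) ^ f \<le> (G + 1) ^ 7" by (intro power_increasing) auto
  from f(2) obtain i m where "n = 2 ^ i * m" "m \<le> (G + 1) ^ f" by blast
  then show ?thesis using le_trans[OF _ le'] by blast
qed

subsection \<open>Sets of reals of order type \<open>\<omega>\<close> squared\<close>

text \<open>Ranking each element by the number of smaller ones maps initial segments of
  \<open>X\<close> onto initial segments of the naturals. As \<open>X\<close> is infinite the
  ranking is onto, and its inverse is the enumeration.\<close>

lemma strict_mono_enumeration:
  fixes X :: "real set"
  assumes "infinite X" and fin: "\<And>x. x \<in> X \<Longrightarrow> finite (X \<inter> {..x})"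
  shows "\<exists>h :: nat \<Rightarrow> real. strict_mono h \<and> range h = X"
proof -
  define pos where "pos x = card (X \<inter> {..<x})" for x
  have fin': "finite (X \<inter> {..<x})" if "x \<in> X" for x
    by (rule finite_subset[OF _ fin[OF that]]) auto
  have mono: "pos x < pos y" if "x \<in> X" "y \<in> X" "x < y" for x y
    unfolding pos_def using that fin'[OF that(2)] by (intro psubset_card_mono) auto
  have inj: "inj_on pos X"
    by (rule inj_onI) (metis linorder_neqE_linordered_idom mono less_irrefl)
  have down: "pos ` (X \<inter> {..<x}) = {..<pos x}" if "x \<in> X" for x
  proof (rule card_subset_eq)
    show "card (pos ` (X \<inter> {..<x})) = card {..<pos x}"
      using card_image[OF inj_on_subset[OF inj, of "X \<inter> {..<x}"]] by (simp add: pos_def[of x])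
  qed (use mono that in auto)
  have "infinite (pos ` X)" using assms(1) inj by (simp add: finite_image_iff)
  have surj: "k \<in> pos ` X" for k
  proof -
    obtain x where "x \<in> X" "k < pos x"
      using \<open>infinite (pos ` X)\<close> finite_subset[of "pos ` X" "{..k}"] by fastforce
    then show ?thesis using down by blast
  qed
  define h where "h = inv_into X pos"
  have h: "h k \<in> X" "pos (h k) = k" for k
    unfolding h_def using surj by (auto intro: inv_into_into f_inv_into_f)
  have "strict_mono h"
    by (rule strict_monoI) (metis h mono linorder_neqE_linordered_idom less_asym less_irrefl)
  moreover have "range h = X"
    using h inj by (force simp: inj_on_def image_iff)
  ultimately show ?thesis by blast
qed

text \<open>Each block \<open>{c k..<c (Suc k)}\<close> meets \<open>D\<close> in a set of type
  omega, and stacking the blocks gives the lexicographic order on block number and position. For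
  \<open>r < c k\<close> the part up to \<open>r\<close> is an initial segment missing the whole
  block \<open>k\<close>, hence a proper one.\<close>

lemma omega_sq_order_type:
  fixes c :: "nat \<Rightarrow> real"
  assumes c: "strict_mono c"
    and cover: "D \<subseteq> (\<Union>k. {c k..<c (Suc k)})"
    and inf: "\<And>k. infinite (D \<inter> {c k..<c (Suc k)})"
    and fin: "\<And>k y. y < c (Suc k) \<Longrightarrow> finite (D \<inter> {c k..y})"
  shows "has_order_type D omega_sq"
    and "\<And>r k. r < c k \<Longrightarrow> order_type_less (D \<inter> {..r}) omega_sq"
proof -
  have "\<exists>h :: nat \<Rightarrow> real. strict_mono h \<and> range h = D \<inter> {c k..<c (Suc k)}" for k
  proof (rule strict_mono_enumeration[OF inf])
    fix x assume "x \<in> D \<inter> {c k..<c (Suc k)}"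
    then show "finite (D \<inter> {c k..<c (Suc k)} \<inter> {..x})"
      by (intro finite_subset[OF _ fin[of x k]]) auto
  qed
  then obtain h :: "nat \<Rightarrow> nat \<Rightarrow> real"
    where h: "\<And>k. strict_mono (h k)" "\<And>k. range (h k) = D \<inter> {c k..<c (Suc k)}"
    by metis
  have hin: "h k j \<in> D" "c k \<le> h k j" "h k j < c (Suc k)" for k j
    using h(2)[of k] by auto
  define g where "g = (\<lambda>(k, j). h k j)"
  have less: "g p < g q" if le: "(p, q) \<in> omega_sq" "p \<noteq> q" for p q
  proof -
    obtain a b a' b' where pq: "p = (a, b)" "q = (a', b')" by (cases p, cases q)
    then consider "a < a'" | "a = a'" "b < b'" using le by (auto simp: omega_sq_def)
    then show ?thesis
    proof cases
      case 1
      then have "c (Suc a) \<le> c a'" using c by (simp add: strict_mono_less_eq)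
      then show ?thesis using hin(3)[of a b] hin(2)[of a' b'] by (simp add: g_def pq)
    next
      case 2
      then show ?thesis using h(1) by (simp add: g_def pq strict_mono_less)
    qed
  qed
  have total: "(p, q) \<in> omega_sq \<or> (q, p) \<in> omega_sq" for p q
    by (cases p; cases q) (auto simp: omega_sq_def)
  have iff: "g p \<le> g q \<longleftrightarrow> (p, q) \<in> omega_sq" for p q
    using less[of p q] less[of q p] total[of p q] by (cases "p = q") (auto simp: omega_sq_def)
  have inj: "inj g"
    by (rule injI) (metis less less_irrefl total)
  have range: "range g = D"
  proof
    show "range g \<subseteq> D" using hin by (auto simp: g_def)
    show "D \<subseteq> range g"
    proof
      fix x assume "x \<in> D"
      then obtain k where "x \<in> D \<inter> {c k..<c (Suc k)}" using cover by blast
      then obtain j where "x = h k j" using h(2)[of k] by blast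
      then have "x = g (k, j)" by (simp add: g_def)
      then show "x \<in> range g" by blast
    qed
  qed
  have "dir_image omega_sq g = relation_of (\<le>) D"
    unfolding dir_image_def relation_of_def range[symmetric] using iff by fastforce
  then have iso: "(omega_sq, relation_of (\<le>) D) \<in> ordIso"
    using dir_image_ordIso[OF Well_order_omega_sq, of g] inj by (metis inj_on_subset subset_UNIV)
  then show "has_order_type D omega_sq"
    unfolding has_order_type_def by (rule ordIso_symmetric)
  have wo: "Well_order (relation_of (\<le>) D)"
    using iso by (simp add: ordIso_def)
  have field: "Field (relation_of (\<le>) D) = D"
    by (auto simp: Field_def relation_of_def)
  fix r k assume r: "r < c k"
  have "wo_rel.ofilter (relation_of (\<le>) D) (D \<inter> {..r})"
    unfolding wo_rel.ofilter_def[OF wo_rel.intro[OF wo]] field under_def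
    by (auto simp: relation_of_def)
  moreover have "h k 0 \<in> D - {..r}" using hin(1,2)[of k 0] r by auto
  ultimately have "(Restr (relation_of (\<le>) D) (D \<inter> {..r}), relation_of (\<le>) D) \<in> ordLess"
    using ofilter_ordLess[OF wo] field by blast
  moreover have "Restr (relation_of (\<le>) D) (D \<inter> {..r}) = relation_of (\<le>) (D \<inter> {..r})"
    by (auto simp: relation_of_def)
  ultimately show "order_type_less (D \<inter> {..r}) omega_sq"
    unfolding order_type_less_def using iso ordIso_symmetric ordLess_ordIso_trans by metis
qed

subsection \<open>Chain lengths and defects of an admissible set\<close>

lemma chain_set_set_of_chain:
  assumes "addition_chain_for n c"
  shows "chain_set (set c)" "n \<in> set c"
proof -
  have c: "c \<noteq> []" "c ! 0 = 1" "c ! (length c - 1) = n"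
    "\<And>k. 1 \<le> k \<Longrightarrow> k < length c \<Longrightarrow> \<exists>i<k. \<exists>j<k. c ! k = c ! i + c ! j"
    using assms by (auto simp: addition_chain_for_def)
  then show "n \<in> set c" by (metis diff_less length_greater_0_conv nth_mem zero_less_one)
  have pos: "c ! k > 0" if "k < length c" for k
    using that
  proof (induction k rule: less_induct)
    case (less k)
    show ?case
    proof (cases "k = 0")
      case False
      then obtain i j where "i < k" "j < k" "c ! k = c ! i + c ! j"
        using c(4)[of k] less.prems by (metis One_nat_def Suc_leI gr0I)
      then show ?thesis using less.IH[of i] less.prems by simp
    qed (simp add: c(2))
  qed
  have "1 \<in> set c" using c(1,2) by (metis length_greater_0_conv nth_mem)
  moreover have "c ! k = 1 \<or> (\<exists>y\<in>set c. \<exists>z\<in>set c. c ! k = y + z)"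
    if k: "k < length c" for k
  proof (cases "k = 0")
    case False
    then obtain i j where "i < k" "j < k" "c ! k = c ! i + c ! j"
      using c(4)[of k] k by (metis One_nat_def Suc_leI gr0I)
    moreover have "c ! i \<in> set c" "c ! j \<in> set c" using calculation k by auto
    ultimately show ?thesis by blast
  qed (simp add: c(2))
  then have "\<forall>x\<in>set c. x = 1 \<or> (\<exists>y\<in>set c. \<exists>z\<in>set c. x = y + z)"
    by (metis in_set_conv_nth)
  moreover have "0 \<notin> set c" using pos by (metis in_set_conv_nth less_irrefl)
  ultimately show "chain_set (set c)"
    by (simp add: chain_set_def)
qed

text \<open>No carry occurs, so only bit \<open>i\<close> can be new. Iterated, this bounds
  \<open>nu2\<close> of sums of distinct powers of two, which admissibility turns into bounds on
  \<open>ell\<close>.\<close>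

lemma nu2_add_power_le:
  assumes "m < 2 ^ i"
  shows "nu2 (2 ^ i + m) \<le> Suc (nu2 m)"
proof -
  have fin: "finite {k. bit m k}"
  proof (rule finite_subset)
    show "{k. bit m k} \<subseteq> {..m}"
    proof
      fix k assume "k \<in> {k. bit m k}"
      then have "m div 2 ^ k \<noteq> 0" by (auto simp: bit_iff_odd intro!: Nat.gr0I)
      then have "2 ^ k \<le> m" by (meson div_less not_le)
      then have "k \<le> m" using less_exp[of k] by linarith
      then show "k \<in> {..m}" by simp
    qed
  qed simp
  have "{k. bit (2 ^ i + m) k} \<subseteq> insert i {k. bit m k}"
  proof
    fix k assume "k \<in> {k. bit (2 ^ i + m) k}"
    then have odd: "odd ((2 ^ i + m) div 2 ^ k)" by (simp add: bit_iff_odd)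
    consider "k < i" | "k = i" | "i < k" by linarith
    then show "k \<in> insert i {k. bit m k}"
    proof cases
      case 1
      then obtain d where i: "i = Suc (k + d)" using less_imp_Suc_add by blast
      then have "2 ^ i + m = m + 2 * 2 ^ d * 2 ^ k" by (simp add: power_add)
      then have "(2 ^ i + m) div 2 ^ k = m div 2 ^ k + 2 * 2 ^ d" by simp
      then show ?thesis using odd by (simp add: bit_iff_odd)
    next
      case 3
      have "(2::nat) ^ Suc i \<le> 2 ^ k" using 3 by (intro power_increasing) auto
      then have "(2 ^ i + m) div 2 ^ k = 0" using assms by simp
      then show ?thesis using odd by simp
    qed simp
  qed
  then have "card {k. bit (2 ^ i + m) k} \<le> card (insert i {k. bit m k})"
    using fin by (intro card_mono) auto
  also have "\<dots> \<le> Suc (card {k. bit m k})" by (rule card_insert_le_m1) auto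
  finally show ?thesis by (simp add: nu2_def)
qed

lemma nu2_0: "nu2 0 = 0"
  by (simp add: nu2_def)

text \<open>The block ends and their shifts have the form \<open>p - log 2 u\<close>; exponentiating
  removes the logarithms from comparisons with them.\<close>

lemma defect_le_iff:
  assumes "n \<ge> 1" "0 < u"
  shows "defect A n \<le> real p - log 2 u \<longleftrightarrow> 2 ^ ell A n * u \<le> 2 ^ p * real n"
    and "real p - log 2 u \<le> defect A n \<longleftrightarrow> 2 ^ p * real n \<le> 2 ^ ell A n * u"
proof -
  have "log 2 (2 ^ ell A n * u) = real (ell A n) + log 2 u"
    "log 2 (2 ^ p * real n) = real p + log 2 (real n)"
    using assms by (simp_all add: log_mult log_nat_power)
  moreover have "0 < 2 ^ ell A n * u" "0 < 2 ^ p * real n" using assms by simp_all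
  ultimately show "defect A n \<le> real p - log 2 u \<longleftrightarrow> 2 ^ ell A n * u \<le> 2 ^ p * real n"
    "real p - log 2 u \<le> defect A n \<longleftrightarrow> 2 ^ p * real n \<le> 2 ^ ell A n * u"
    unfolding defect_def
    using log_le_cancel_iff[of 2 "2 ^ ell A n * u" "2 ^ p * real n"]
      log_le_cancel_iff[of 2 "2 ^ p * real n" "2 ^ ell A n * u"] by auto
qed

lemma defect_eq:
  assumes "ell A n = t + p" "real n = 2 ^ t * u" "0 < u"
  shows "defect A n = real p - log 2 u"
  using assms by (simp add: defect_def log_mult log_nat_power)

lemma small_if_defect_le_2:
  assumes "n \<ge> 1" "defect A n \<le> 2"
  shows "2 ^ ell A n \<le> 4 * n"
proof -
  have "2 ^ ell A n \<le> 4 * real n"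
    using defect_le_iff(1)[OF assms(1), where u = 1 and p = 2] assms(2) by simp
  then show ?thesis by (metis of_nat_le_iff of_nat_mult of_nat_numeral of_nat_power)
qed

context
  fixes A :: "nat list set"
  assumes adm: "admissible A"
begin

text \<open>Condition (i) ensures that the \<open>LEAST\<close> in \<open>ell\<close> is attained.
  Repeated entries of a list shrink its set, hence only an inequality.\<close>

lemma ell_chain_set:
  assumes "n \<ge> 1"
  obtains S where "chain_set S" "n \<in> S" "card S \<le> Suc (ell A n)"
proof -
  have "ell_defined A n" using adm assms by (simp add: admissible_def)
  then have "\<exists>r. \<exists>c\<in>A. addition_chain_for n c \<and> chain_length c = r"
    unfolding ell_defined_def by blast
  then have "\<exists>c\<in>A. addition_chain_for n c \<and> chain_length c = ell A n"
    unfolding ell_def by (rule LeastI_ex)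
  then obtain c where c: "addition_chain_for n c" "length c - 1 = ell A n"
    unfolding chain_length_def by blast
  have "card (set c) \<le> Suc (ell A n)" using card_length[of c] c(2) by simp
  then show thesis using that chain_set_set_of_chain[OF c(1)] by blast
qed

lemma le_two_power_ell:
  assumes "n \<ge> 1"
  shows "n \<le> 2 ^ ell A n"
proof -
  obtain S where S: "chain_set S" "n \<in> S" "card S \<le> Suc (ell A n)"
    using ell_chain_set[OF assms] by blast
  have "2 * n \<le> 2 ^ card S" using chain_set_size S by blast
  also have "\<dots> \<le> 2 ^ Suc (ell A n)" using S(3) by (intro power_increasing) auto
  finally show ?thesis by simp
qed

lemma two_powers_ell:
  assumes "n \<ge> 1" "2 ^ ell A n \<le> 2 * n"
  shows "two_powers n"
proof -
  obtain S where S: "chain_set S" "n \<in> S" "card S \<le> Suc (ell A n)"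
    using ell_chain_set[OF assms(1)] by blast
  have "(2::nat) ^ card S \<le> 2 ^ Suc (ell A n)" using S(3) by (intro power_increasing) auto
  then have "2 ^ card S \<le> 4 * n" using assms(2) by simp
  then show ?thesis using chain_set_two_powers S by blast
qed

lemma ell_le:
  assumes "2 ^ t \<le> n" "n < 2 ^ Suc t"
  shows "ell A n + 1 \<le> t + nu2 n"
proof -
  have "\<lfloor>log 2 (real n)\<rfloor> = int t"
    using floor_log_nat_eq_if[of 2 t n] assms by simp
  moreover have "n \<ge> 1" using assms(1) by (cases n) auto
  from adm[unfolded admissible_def, THEN conjunct1, rule_format, OF this]
  have "int (ell A n) \<le> \<lfloor>log 2 (real n)\<rfloor> + int (nu2 n) - 1" by simp
  ultimately show ?thesis by linarith
qed

lemma ell_power_le: "ell A (2 ^ i) \<le> i"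
  using ell_le[of i "2 ^ i"] nu2_add_power_le[of 0 i] by (simp add: nu2_0)

lemma ell_two_powers_le:
  assumes "j < i"
  shows "ell A (2 ^ i + 2 ^ j) \<le> Suc i"
proof -
  have "nu2 (2 ^ j) \<le> 1" using nu2_add_power_le[of 0 j] by (simp add: nu2_0)
  moreover have less: "(2::nat) ^ j < 2 ^ i" using assms by simp
  ultimately have "nu2 (2 ^ i + 2 ^ j) \<le> 2" using nu2_add_power_le[of "2 ^ j" i] by linarith
  then show ?thesis using ell_le[of i "2 ^ i + 2 ^ j"] less by simp
qed

lemma ell_three_powers_le:
  assumes "k < j" "j < i"
  shows "ell A (2 ^ i + (2 ^ j + 2 ^ k)) \<le> Suc (Suc i)"
proof -
  have "nu2 (2 ^ k) \<le> 1" using nu2_add_power_le[of 0 k] by (simp add: nu2_0)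
  moreover have kj: "(2::nat) ^ k < 2 ^ j" using assms by simp
  moreover have ji: "(2::nat) ^ j + 2 ^ k < 2 ^ i"
  proof -
    have "(2::nat) ^ Suc j \<le> 2 ^ i" using assms(2) by (intro power_increasing) auto
    then show ?thesis using kj power_Suc[of "2::nat" j] by linarith
  qed
  ultimately have "nu2 (2 ^ i + (2 ^ j + 2 ^ k)) \<le> 3"
    using nu2_add_power_le[of "2 ^ k" j] nu2_add_power_le[of "2 ^ j + 2 ^ k" i] by linarith
  then show ?thesis using ell_le[of i "2 ^ i + (2 ^ j + 2 ^ k)"] ji by simp
qed

lemma ell_shift_le: "n \<ge> 1 \<Longrightarrow> ell A (2 ^ k * n) \<le> ell A n + k"
proof (induction k)
  case (Suc k)
  have "ell A (2 * (2 ^ k * n)) \<le> ell A (2 ^ k * n) + 1"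
    using adm Suc.prems by (simp add: admissible_def)
  then show ?case using Suc by (simp add: mult.assoc)
qed simp

text \<open>A drop at some \<open>2 ^ k * n\<close> would leave a chain losing at most a factor 2,
  so \<open>2 ^ k * n\<close>, and with it \<open>n\<close>, would have at most two binary ones. For
  such \<open>n\<close> the upper bound on \<open>ell A n\<close> from condition (i) already matches
  the lower bound on \<open>ell A (2 ^ k * n)\<close> from size, which excludes the drop.\<close>

lemma stable_number_if_small:
  assumes "n \<ge> 1" "2 ^ ell A n \<le> 4 * n"
  shows "stable_number A n"
proof -
  have "ell A (2 ^ k * n) = ell A n + k" for k
  proof (rule ccontr)
    define L where "L = ell A (2 ^ k * n)"
    assume "ell A (2 ^ k * n) \<noteq> ell A n + k"
    then have L: "L < ell A n + k" using ell_shift_le[OF assms(1), of k] by (simp add: L_def)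
    have pos: "2 ^ k * n \<ge> 1" using assms(1) by simp
    have upper: "2 ^ k * n \<le> 2 ^ L" unfolding L_def by (rule le_two_power_ell[OF pos])
    have "2 * 2 ^ L \<le> (2::nat) ^ (ell A n + k)"
      using power_increasing[of "Suc L" "ell A n + k" "2::nat"] L by simp
    also have "\<dots> \<le> 4 * (2 ^ k * n)" using assms(2) by (simp add: power_add)
    finally have "2 ^ L \<le> 2 * (2 ^ k * n)" by linarith
    then have "two_powers (2 ^ k * n)"
      unfolding L_def by (rule two_powers_ell[OF pos])
    then have tp: "two_powers n" by (rule two_powers_cancel)
    obtain t where t: "2 ^ t \<le> n" "n < 2 ^ Suc t"
      using ex_power_ivl1[of 2 n] assms(1) by auto
    from two_powers_normal[OF tp t] consider "n = 2 ^ t" | e where "e < t" "n = 2 ^ t + 2 ^ e"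
      by blast
    then show False
    proof cases
      case 1
      then have "t + k \<le> L" using upper by (simp add: power_add[symmetric] add.commute)
      then show False using L ell_power_le[of t] 1 by simp
    next
      case 2
      then have "L \<le> t + k" using L ell_two_powers_le[of e t] by simp
      then have "(2::nat) ^ L \<le> 2 ^ k * 2 ^ t"
        using power_increasing[of L "t + k" "2::nat"] by (simp add: power_add mult.commute)
      then have "2 ^ k * n \<le> 2 ^ k * 2 ^ t" using upper by linarith
      then show False using 2 by simp
    qed
  qed
  then show ?thesis using assms(1) by (simp add: stable_number_def)
qed

text \<open>Defect exactly 2 would mean \<open>2 ^ ell A n = 4 * n\<close>, so \<open>n\<close>
  would be a power of two, but \<open>ell A (2 ^ t)\<close> is at most \<open>t\<close>.\<close>

lemma defect_less_2:
  assumes "n \<ge> 1" "defect A n \<le> 2"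
  shows "defect A n < 2"
proof (rule ccontr)
  assume "\<not> defect A n < 2"
  then have "4 * real n \<le> 2 ^ ell A n"
    using defect_le_iff(2)[OF assms(1), where A = A and u = 1 and p = 2] by simp
  then have "4 * n \<le> 2 ^ ell A n"
    by (metis of_nat_le_iff of_nat_mult of_nat_numeral of_nat_power)
  then have eq: "2 ^ ell A n = 4 * n" using small_if_defect_le_2[OF assms] by simp
  have "\<not> ell A n < 2"
  proof
    assume "ell A n < 2"
    then have "ell A n = 0 \<or> ell A n = 1" by linarith
    then show False using eq assms(1) by auto
  qed
  then obtain t where t: "ell A n = Suc (Suc t)" by (metis add_2_eq_Suc le_add_diff_inverse not_less)
  then have "n = 2 ^ t" using eq by simp
  then show False using ell_power_le[of t] t by simp
qed

end

section \<open>Blocks of defects between consecutive accumulation points\<close>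

definition block_start :: "nat \<Rightarrow> real" where
  "block_start k = (case k of 0 \<Rightarrow> 0 | Suc j \<Rightarrow> 2 - log 2 (1 + (1/2) ^ j))"

text \<open>The values are 0, 1, \<open>2 - log 2 (3/2)\<close> and so on, tending to 2. Index 0
  opens the first block; the shift of the exponent gives index 1 the value 1, and from there on the
  values are the accumulation points below 2.\<close>

lemma block_start_0 [simp]: "block_start 0 = 0"
  and block_start_Suc: "block_start (Suc k) = 2 - log 2 (1 + (1/2) ^ k)"
  by (simp_all add: block_start_def)

lemma strict_mono_block_start: "strict_mono block_start"
  unfolding strict_mono_Suc_iff
proof
  fix k
  show "block_start k < block_start (Suc k)"
  proof (cases k)
    case (Suc j)
    have "log 2 (1 + (1/2) ^ Suc j) < log 2 (1 + (1/2::real) ^ j)"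
      by (subst log_less_cancel_iff) (auto simp: add_pos_pos)
    then show ?thesis using Suc by (simp add: block_start_Suc)
  qed (simp add: block_start_Suc)
qed

lemma block_start_less_2: "block_start k < 2"
proof (cases k)
  case (Suc j)
  have "1 < 1 + (1/2::real) ^ j" by simp
  then have "0 < log 2 (1 + (1/2) ^ j)" by (subst zero_less_log_cancel_iff) (auto simp: add_pos_pos)
  then show ?thesis by (simp add: Suc block_start_Suc)
qed simp

lemma block_start_nonneg: "0 \<le> block_start k"
  using strict_mono_less_eq[OF strict_mono_block_start, of 0 k] by simp

lemma ex_block_start_greater:
  assumes "r < 2"
  shows "\<exists>k. r < block_start k"
proof -
  have "1 < 2 powr (2 - r)" using assms by simp
  then obtain k where k: "(1/2) ^ k < 2 powr (2 - r) - 1"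
    using real_arch_pow_inv[of "2 powr (2 - r) - 1" "1/2"] by auto
  have "log 2 (1 + (1/2) ^ k) < log 2 (2 powr (2 - r))"
    using k by (subst log_less_cancel_iff) (auto simp: add_pos_pos)
  then show ?thesis by (intro exI[of _ "Suc k"]) (simp add: block_start_Suc)
qed

text \<open>Only \<open>r - i\<close> and \<open>m\<close> matter. From \<open>0 \<le> x\<close>
  follows \<open>i \<le> r\<close>, and \<open>x \<le> 2\<close> with
  \<open>log 2 m < m \<le> B\<close> gives \<open>r - i \<le> B + 2\<close>.\<close>

lemma finite_bounded_odd_part:
  "finite {x. \<exists>r i m. x = real r - log 2 (real (2 ^ i * m)) \<and> 1 \<le> m \<and> m \<le> B \<and> 0 \<le> x \<and> x \<le> 2}"
  (is "finite ?X")
proof (rule finite_subset)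
  show "?X \<subseteq> (\<lambda>(j, m). real j - log 2 (real m)) ` ({..B + 2} \<times> {..B})"
  proof
    fix x assume "x \<in> ?X"
    then obtain r i m where x: "x = real r - log 2 (real (2 ^ i * m))" "1 \<le> m" "m \<le> B" "0 \<le> x" "x \<le> 2"
      by blast
    have eq: "x = real r - real i - log 2 (real m)"
      using x(1,2) by (simp add: log_mult log_nat_power)
    have nn: "0 \<le> log 2 (real m)" using x(2) by simp
    have "log 2 (real m) < real m"
      using less_exp[of m] x(2) by (subst log_less_iff) (simp_all add: powr_realpow)
    then have "real r \<le> real (i + B + 2)" "real i \<le> real r" using nn eq x(3-5) by auto
    then have "r - i \<le> B + 2" "real (r - i) = real r - real i" by auto
    then have "x = (\<lambda>(j, m). real j - log 2 (real m)) (r - i, m)" "(r - i, m) \<in> {..B + 2} \<times> {..B}"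
      using eq x(3) by auto
    then show "x \<in> (\<lambda>(j, m). real j - log 2 (real m)) ` ({..B + 2} \<times> {..B})" by blast
  qed
qed simp

text \<open>Strictly between \<open>2 ^ r\<close> and \<open>2 ^ Suc r\<close>, numbers with two
  binary ones are \<open>2 ^ r * (1 + (1/2) ^ d)\<close>, and the window lies between consecutive
  values of this form.\<close>

lemma near_two_powers_eq:
  assumes "two_powers m" "2 ^ r * (1 + (1/2) ^ Suc k) < real m" "real m \<le> 2 ^ r * (1 + (1/2) ^ k)"
  shows "real m = 2 ^ r * (1 + (1/2) ^ k)"
proof -
  have pos: "0 < 2 ^ r * (1/2::real) ^ Suc k" by simp
  have "(2::real) ^ r < 2 ^ r * (1 + (1/2) ^ Suc k)" using pos by (simp add: distrib_left)
  then have "(2::real) ^ r < real m" using assms(2) by linarith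
  then have "real (2 ^ r) < real m" by (simp only: of_nat_power of_nat_numeral)
  then have lo: "2 ^ r < m" by (simp only: of_nat_less_iff)
  have le: "2 ^ r * (1 + (1/2) ^ k) \<le> (2::real) ^ r * 2"
    by (intro mult_left_mono) (auto simp: power_le_one)
  then have "real m \<le> 2 ^ r * 2" using assms(3) by linarith
  then have "real m \<le> real (2 ^ Suc r)" by simp
  then have hi: "m \<le> 2 ^ Suc r" by (simp only: of_nat_le_iff)
  show ?thesis
  \<comment> \<open>The value \<open>2 ^ Suc r\<close> is the case \<open>d = 0\<close>; it fits the
    window only as its right end.\<close>
  proof (cases "m = 2 ^ Suc r")
    case True
    then have "(2::real) ^ r * 2 \<le> 2 ^ r * (1 + (1/2) ^ k)" using assms(3) by simp
    then show ?thesis using True le by simp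
  next
    case False
    then obtain e where e: "e < r" "m = 2 ^ r + 2 ^ e"
      using two_powers_normal[OF assms(1), of r] lo hi by auto
    define d where "d = r - e"
    have "r = e + d" using e(1) by (simp add: d_def)
    then have m: "real m = 2 ^ r * (1 + (1/2) ^ d)"
      using e(2) by (simp add: power_add field_simps)
    have "(1/2::real) ^ Suc k < (1/2) ^ d" "(1/2::real) ^ d \<le> (1/2) ^ k"
      using assms(2,3) unfolding m by simp_all
    moreover have "(1/2::real) ^ d \<le> (1/2) ^ Suc k" if "Suc k \<le> d"
      using that by (intro power_decreasing) auto
    moreover have "(1/2::real) ^ k < (1/2) ^ d" if "d < k"
      using that by (intro power_strict_decreasing) auto
    ultimately have "d = k" by (meson not_less leD le_antisym less_Suc_eq_le)
    then show ?thesis using m by simp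
  qed
qed

context
  fixes A :: "nat list set"
  assumes adm: "admissible A"
begin

text \<open>If a step with very unequal summands could be dropped, the slightly smaller number obtained would be too large for its
  chain length: it would exceed the maximal power of two (first block), or be a sum of two powers of two
  strictly between consecutive such sums.\<close>
lemma bounded_odd_part_in_block:
  assumes "y < block_start (Suc k)"
  shows "\<exists>B. \<forall>n\<ge>1. block_start k \<le> defect A n \<longrightarrow> defect A n \<le> y \<longrightarrow>
    defect A n = block_start k \<or> (\<exists>i m. n = 2 ^ i * m \<and> m \<le> B)"
proof -
  \<comment> \<open>\<open>w\<close> is the multiplicative slack between \<open>y\<close> and the
    right end of the block.\<close>
  define w where "w = 2 powr (block_start (Suc k) - y)"
  have "w > 1" using assms by (simp add: w_def)
  \<comment> \<open>This choice makes \<open>(G + 1) / G < w\<close>, so truncation shrinks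
    \<open>n\<close> by a factor smaller than \<open>w\<close>.\<close>
  then obtain G where G: "1 / (w - 1) < real G" using reals_Archimedean2 by blast
  have "0 < 1 / (w - 1)" using \<open>w > 1\<close> by simp
  then have "G > 0" using G by (metis less_trans of_nat_0_less_iff)
  then have Gw: "real (G + 1) < real G * w" using G \<open>w > 1\<close> by (simp add: field_simps)
  have logw: "block_start (Suc k) - log 2 w = y" by (simp add: w_def)
  have "defect A n = block_start k \<or> (\<exists>i m. n = 2 ^ i * m \<and> m \<le> (G + 1) ^ 7)"
    if n: "n \<ge> 1" "block_start k \<le> defect A n" "defect A n \<le> y" for n
  proof (rule ccontr)
    assume neg: "\<not> ?thesis"
    define r where "r = ell A n"
    obtain S where S: "chain_set S" "n \<in> S" "card S \<le> Suc r"
      using ell_chain_set[OF adm n(1)] unfolding r_def by blast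
    have "defect A n \<le> 2" using n(3) assms block_start_less_2[of "Suc k"] by simp
    then have "2 ^ r \<le> 4 * n" unfolding r_def by (rule small_if_defect_le_2[OF n(1)])
    moreover have "(2::nat) ^ card S \<le> 2 ^ Suc r" using S(3) by (intro power_increasing) auto
    ultimately have "2 ^ card S \<le> 8 * n" by simp
    from chain_set_dichotomy[OF S(1,2) this, of G] neg
    obtain T n' where T: "chain_set T" "n' \<in> T" "card T < card S" "n' \<le> n" "G * n \<le> (G + 1) * n'"
      by blast
    have cardT: "(2::nat) ^ card T \<le> 2 ^ r" using T(3) S(3) by (intro power_increasing) auto
    have nn': "w * (real G * real n) \<le> w * (real (G + 1) * real n')"
      using T(5) \<open>w > 1\<close> by (intro mult_left_mono) (metis of_nat_le_iff of_nat_mult, simp)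
    have "real (G + 1) * real n' < real G * w * real n'"
      using Gw chain_set_pos[OF T(1,2)] by simp
    then have "w * (real (G + 1) * real n') < w * (real G * w * real n')"
      using \<open>w > 1\<close> by simp
    then have "real G * w * real n < real G * w * (w * real n')"
      using nn' by (simp add: mult_ac)
    then have less: "real n < w * real n'" using \<open>G > 0\<close> \<open>w > 1\<close> by simp
    show False
    proof (cases k)
      case 0
      \<comment> \<open>In the first block the slack gives \<open>2 ^ r < 2 * n'\<close>, against
        the size bound for \<open>T\<close>, which has at most \<open>r\<close> elements.\<close>
      then have "defect A n \<le> real 1 - log 2 w" using n(3) logw by (simp add: block_start_Suc)
      then have "2 ^ r * w \<le> 2 * real n"
        using defect_le_iff(1)[OF n(1), where u = w and p = 1] \<open>w > 1\<close> by (simp add: r_def)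
      also have "\<dots> < w * (2 * real n')" using less by simp
      finally have "2 ^ r < 2 * real n'" using \<open>w > 1\<close> by (simp add: mult.commute)
      then have "real (2 ^ r) < real (2 * n')" by simp
      then have "2 ^ r < 2 * n'" by (simp only: of_nat_less_iff)
      then show False using chain_set_size[OF T(1,2)] cardT by linarith
    next
      case (Suc j)
      define u :: real where "u = 1 + (1/2) ^ Suc j"
      have u: "u > 0" by (simp add: u_def add_pos_pos)
      have "block_start (Suc k) = 2 - log 2 u" by (simp add: Suc block_start_Suc u_def)
      then have "defect A n \<le> real 2 - log 2 (u * w)"
        using n(3) logw u \<open>w > 1\<close> by (simp add: log_mult)
      then have "2 ^ r * (u * w) \<le> 4 * real n"
        using defect_le_iff(1)[OF n(1), where u = "u * w" and p = 2] u \<open>w > 1\<close> by (simp add: r_def)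
      also have "\<dots> < w * (4 * real n')" using less by simp
      finally have "w * (2 ^ r * u) < w * (4 * real n')" by (simp add: mult_ac)
      then have lower: "2 ^ r * u < real (4 * n')" using \<open>w > 1\<close> by simp
      have v: "(0::real) < 1 + (1/2) ^ j" by (simp add: add_pos_pos)
      have bs: "block_start k = real 2 - log 2 (1 + (1/2) ^ j)" by (simp add: Suc block_start_Suc)
      then have upper: "real (4 * n) \<le> 2 ^ r * (1 + (1/2) ^ j)"
        using n(2) defect_le_iff(2)[OF n(1) v, where p = 2] by (simp add: r_def)
      have "(2::real) ^ r \<le> 2 ^ r * u" by (simp add: u_def)
      then have "(2::real) ^ r < real (4 * n')" using lower by linarith
      then have "real (2 ^ r) < real (4 * n')" by (simp only: of_nat_power of_nat_numeral)
      then have "2 ^ r < 4 * n'" by (simp only: of_nat_less_iff)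
      then have "two_powers n'" using chain_set_two_powers[OF T(1,2) _ T(2)] cardT by linarith
      then have "two_powers (4 * n')" using two_powers_double[OF two_powers_double] by fastforce
      moreover have "real (4 * n') \<le> real (4 * n)" using T(4) by simp
      \<comment> \<open>So \<open>4 * n'\<close> is the right end of a window that also bounds
        \<open>4 * n\<close>. As \<open>n' \<le> n\<close>, the defect of \<open>n\<close> is
        \<open>block_start k\<close>, which was excluded.\<close>
      ultimately have "real (4 * n') = 2 ^ r * (1 + (1/2) ^ j)"
        using near_two_powers_eq lower upper unfolding u_def by (meson order_trans)
      then have "2 ^ r * (1 + (1/2) ^ j) \<le> 2 ^ 2 * real n" using T(4) by simp
      then have "defect A n \<le> block_start k"
        unfolding bs using defect_le_iff(1)[OF n(1) v, where p = 2] by (simp add: r_def)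
      then show False using n(2) neg by simp
    qed
  qed
  then show ?thesis by blast
qed

text \<open>A bounded cofactor leaves finitely many defects, and the left end adds at most one
  value.\<close>

lemma finite_defects_in_block:
  assumes "y < block_start (Suc k)"
  shows "finite (defects A \<inter> {block_start k..y})"
proof -
  obtain B where B: "\<And>n. n \<ge> 1 \<Longrightarrow> block_start k \<le> defect A n \<Longrightarrow> defect A n \<le> y \<Longrightarrow>
    defect A n = block_start k \<or> (\<exists>i m. n = 2 ^ i * m \<and> m \<le> B)"
    using bounded_odd_part_in_block[OF assms] by blast
  let ?X = "{x. \<exists>r i m. x = real r - log 2 (real (2 ^ i * m)) \<and> 1 \<le> m \<and> m \<le> B \<and> 0 \<le> x \<and> x \<le> 2}"
  have "defects A \<inter> {block_start k..y} \<subseteq> insert (block_start k) ?X"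
  proof
    fix x assume "x \<in> defects A \<inter> {block_start k..y}"
    then obtain n where n: "n \<ge> 1" "x = defect A n" "block_start k \<le> x" "x \<le> y"
      by (auto simp: defects_def)
    have "0 \<le> x" "x \<le> 2"
      using n(3,4) assms block_start_nonneg[of k] block_start_less_2[of "Suc k"] by simp_all
    moreover have "x = block_start k \<or> (\<exists>i m. n = 2 ^ i * m \<and> m \<le> B)"
      using B[OF n(1)] n(2-4) by simp
    moreover have "1 \<le> m" if "n = 2 ^ i * m" for i m using that n(1) by (cases m) auto
    ultimately show "x \<in> insert (block_start k) ?X"
      using n(2) unfolding defect_def by blast
  qed
  then show ?thesis using finite_bounded_odd_part finite_subset by blast
qed

text \<open>Explicit numbers with two or three binary ones: \<open>ell\<close> is pinned between the
  admissibility bound and the lower bound from chain sets, and the defects increase to the right end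
  of the block.\<close>

lemma infinite_defects_in_block:
  "infinite (defects A \<inter> {block_start k..<block_start (Suc k)})"
proof -
  have "\<exists>f :: nat \<Rightarrow> real. inj f \<and> range f \<subseteq> defects A \<inter> {block_start k..<block_start (Suc k)}"
  proof (cases k)
    case 0
    \<comment> \<open>The numbers are \<open>2 ^ Suc b + 1\<close>, with \<open>u b\<close> the
      ratio to the leading power; \<open>Suc b\<close> keeps the two powers distinct.\<close>
    define u :: "nat \<Rightarrow> real" where "u b = 1 + (1/2) ^ Suc b" for b
    have u: "1 < u b" "u b \<le> 2" for b by (auto simp: u_def power_le_one intro: order_trans[of _ 1])
    have "defect A (2 ^ Suc b + 2 ^ 0) = real 1 - log 2 (u b)" for b
    proof (rule defect_eq)
      have "ell A (2 ^ Suc b + 2 ^ 0) \<le> Suc (Suc b)" by (rule ell_two_powers_le[OF adm]) simp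
      moreover have "(2::nat) ^ Suc b + 2 ^ 0 \<le> 2 ^ ell A (2 ^ Suc b + 2 ^ 0)"
        by (rule le_two_power_ell[OF adm]) simp
      then have "(2::nat) ^ Suc b < 2 ^ ell A (2 ^ Suc b + 2 ^ 0)"
        by (rule less_le_trans[rotated]) simp
      ultimately show "ell A (2 ^ Suc b + 2 ^ 0) = Suc b + 1"
        using power_less_imp_less_exp[of "2::nat" "Suc b"] by fastforce
    qed (use u(1)[of b] in \<open>simp_all add: u_def field_simps add_pos_pos\<close>)
    then have "1 - log 2 (u b) \<in> defects A" for b
      unfolding defects_def by (intro CollectI exI[of _ "2 ^ Suc b + 2 ^ 0"]) simp
    moreover have "0 \<le> 1 - log 2 (u b)" "1 - log 2 (u b) < 1" for b
      using u[of b] by auto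
    moreover have "inj (\<lambda>b. 1 - log 2 (u b))"
    proof (rule injI)
      fix b b' assume "1 - log 2 (u b) = 1 - log 2 (u b')"
      then have "u b = u b'" using less_trans[OF zero_less_one u(1)[of b]] less_trans[OF zero_less_one u(1)[of b']]
        by (simp add: log_def)
      then show "b = b'" by (simp add: u_def power_inject_exp')
    qed
    ultimately show ?thesis
      unfolding 0 by (intro exI[of _ "\<lambda>b. 1 - log 2 (u b)"]) (auto simp: block_start_Suc)
  next
    case (Suc j)
    define u :: "nat \<Rightarrow> real" where "u b = 1 + (1/2) ^ Suc j + (1/2) ^ (Suc j + Suc b)" for b
    have u: "1 + (1/2) ^ Suc j < u b" "u b \<le> 1 + (1/2) ^ j" for b
      using power_decreasing[of "Suc j" "Suc j + Suc b" "1/2::real"] by (simp_all add: u_def)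
    have pos: "(0::real) < 1 + (1/2) ^ i" for i by (simp add: add_pos_pos)
    then have u0: "0 < u b" for b using u(1) less_trans by blast
    \<comment> \<open>Dividing by the leading power gives \<open>u b\<close>; the first gap
      \<open>Suc j\<close> selects the block, and \<open>b\<close> moves inside it.\<close>
    define N :: "nat \<Rightarrow> nat" where "N b = 2 ^ (Suc j + Suc b) + (2 ^ Suc b + 2 ^ 0)" for b
    have "defect A (N b) = real 2 - log 2 (u b)" for b
    proof (rule defect_eq)
      define t where "t = Suc j + Suc b"
      have N: "N b = 2 ^ t + (2 ^ Suc b + 2 ^ 0)" by (simp add: N_def t_def)
      have le: "ell A (N b) \<le> Suc (Suc t)"
        unfolding N by (rule ell_three_powers_le[OF adm]) (simp_all add: t_def)
      \<comment> \<open>Otherwise \<open>2 ^ Suc b + 1\<close> would be a power of two, yet it is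
        odd and exceeds 1. Hence \<open>ell A (N b)\<close> is at least
        \<open>t + 2\<close>.\<close>
      have "\<not> two_powers (N b)"
      proof
        assume tp: "two_powers (N b)"
        have less: "N b < 2 ^ Suc t"
        proof -
          have "(2::nat) ^ Suc (Suc b) \<le> 2 ^ t" by (intro power_increasing) (simp_all add: t_def)
          moreover have "(1::nat) < 2 ^ Suc b" by (rule one_less_power) simp_all
          ultimately show ?thesis by (simp add: N)
        qed
        obtain e where "2 ^ Suc b + 1 = (2::nat) ^ e"
          using two_powers_normal[OF tp _ less] N by auto
        moreover have "odd ((2::nat) ^ Suc b + 1)" by simp
        ultimately have "e = 0" by (metis even_power odd_numeral_BitM even_numeral gr0I)
        then show False using \<open>2 ^ Suc b + 1 = 2 ^ e\<close> by simp
      qed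
      then have "2 * N b < 2 ^ ell A (N b)"
        using two_powers_ell[OF adm, of "N b"] by (fastforce simp: N)
      then have "(2::nat) ^ Suc t < 2 ^ ell A (N b)" by (simp add: N)
      then have "Suc t < ell A (N b)" by (rule power_less_imp_less_exp[rotated]) simp
      then show "ell A (N b) = Suc j + Suc b + 2" using le by (simp add: t_def)
      have "(2::real) ^ t * (1/2) ^ Suc j = 2 ^ Suc b" "(2::real) ^ t * (1/2) ^ t = 1"
        by (simp_all add: t_def power_add power_one_over)
      then show "real (N b) = 2 ^ (Suc j + Suc b) * u b"
        unfolding N u_def t_def[symmetric] distrib_left by simp
    qed (rule u0)
    then have "2 - log 2 (u b) \<in> defects A" for b
      unfolding defects_def by (intro CollectI exI[of _ "N b"]) (simp add: N_def)
    moreover have "2 - log 2 (1 + (1/2) ^ j) \<le> 2 - log 2 (u b)"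
      "2 - log 2 (u b) < 2 - log 2 (1 + (1/2) ^ Suc j)" for b
      using u[of b] u0[of b] pos[of j] pos[of "Suc j"] by (simp_all del: power_Suc)
    moreover have "inj (\<lambda>b. 2 - log 2 (u b))"
    proof (rule injI)
      fix b b' assume "2 - log 2 (u b) = 2 - log 2 (u b')"
      then have "u b = u b'" using u0[of b] u0[of b'] by (simp add: log_def)
      then show "b = b'" by (simp add: u_def power_add power_inject_exp')
    qed
    ultimately show ?thesis
      unfolding Suc block_start_Suc
      by (intro exI[of _ "\<lambda>b. 2 - log 2 (u b)"] conjI image_subsetI IntI) simp_all
  qed
  then show ?thesis by (metis finite_imageD finite_subset infinite_UNIV_nat)
qed

end

section \<open>Assembling the blocks into order type omega^2\<close>

theorem theorem7p3:
  fixes A :: "nat list set"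
  assumes "A \<subseteq> addition_chains"
    and "admissible A"
  shows "has_order_type (defects A \<inter> {0..2}) omega_sq
    \<and> (\<forall>r::real. r < 2 \<longrightarrow> order_type_less (defects A \<inter> {0..r}) omega_sq)
    \<and> (\<forall>d \<in> defects A \<inter> {0..2}. stable_defect A d)
    \<and> has_order_type (stable_defects A \<inter> {0..2}) omega_sq"
proof -
  note adm = assms(2)
  define D where "D = defects A \<inter> {0..2}"
  have block: "D \<inter> {block_start k..y} = defects A \<inter> {block_start k..y}" if "y < block_start (Suc k)" for k y
    using that block_start_nonneg[of k] block_start_less_2[of "Suc k"] by (fastforce simp: D_def)
  have block': "D \<inter> {block_start k..<block_start (Suc k)} = defects A \<inter> {block_start k..<block_start (Suc k)}" for k
    using block_start_nonneg[of k] block_start_less_2[of "Suc k"] by (fastforce simp: D_def)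
  have cover: "D \<subseteq> (\<Union>k. {block_start k..<block_start (Suc k)})"
  proof
    fix x assume "x \<in> D"
    \<comment> \<open>The blocks do not cover the point 2, so it must be known that 2 is not a
      defect.\<close>
    then have x: "0 \<le> x" "x < 2"
      using defect_less_2[OF adm] by (auto simp: D_def defects_def)
    \<comment> \<open>The first block end above \<open>x\<close> has positive index because
      \<open>block_start 0 = 0 \<le> x\<close>; its predecessor opens the block of
      \<open>x\<close>.\<close>
    define K where "K = (LEAST k. x < block_start k)"
    have K: "x < block_start K" unfolding K_def by (rule LeastI_ex) (rule ex_block_start_greater[OF x(2)])
    then obtain k where k: "K = Suc k" using x(1) by (cases K) auto
    then have "block_start k \<le> x" using not_less_Least[of k "\<lambda>k. x < block_start k"] by (simp add: K_def)
    then show "x \<in> (\<Union>k. {block_start k..<block_start (Suc k)})" using K k by auto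
  qed
  note order = omega_sq_order_type[OF strict_mono_block_start cover]
  have inf: "infinite (D \<inter> {block_start k..<block_start (Suc k)})" for k
    unfolding block' by (rule infinite_defects_in_block[OF adm])
  have fin: "finite (D \<inter> {block_start k..y})" if "y < block_start (Suc k)" for k y
    unfolding block[OF that] by (rule finite_defects_in_block[OF adm that])
  have type: "has_order_type D omega_sq" using order(1)[OF inf fin] by blast
  have less: "order_type_less (defects A \<inter> {0..r}) omega_sq" if r: "r < 2" for r
  proof -
    obtain k where "r < block_start k" using ex_block_start_greater[OF r] by blast
    then have "order_type_less (D \<inter> {..r}) omega_sq" using order(2)[OF inf fin] by blast
    moreover have "D \<inter> {..r} = defects A \<inter> {0..r}" using r by (auto simp: D_def)
    ultimately show ?thesis by simp
  qed
  have stable: "stable_defect A d" if "d \<in> D" for d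
    using that stable_number_if_small[OF adm] small_if_defect_le_2
    by (auto simp: D_def defects_def stable_defect_def)
  moreover have "stable_defects A \<subseteq> defects A"
    by (auto simp: stable_defects_def stable_defect_def stable_number_def defects_def)
  ultimately have "stable_defects A \<inter> {0..2} = D"
    unfolding D_def stable_defects_def by blast
  then show ?thesis using type less stable unfolding D_def by simp
qed

end
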